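(* Let $m$ be a positive integer and let $A_k$ be a set of $k$ positive integers of one of the following two forms. (1) $k=2m$ and $A_k=\{a_1<a_2<\dots<a_{2m}\}$, where $a_1=1$; $a_i\ge 8a_{i-1}$ for $2\le i\le m$; $a_{m+i}=2a_m-a_{m-i}$ for $1\le i\le m-1$; and $a_{2m}=2a_m$. (2) $k=2m+1$ and $A_k=\{a_1<a_2<\dots<a_m<\hat a_m<a_{m+1}<\dots<a_{2m}\}$, where $a_1=1$; $a_i\ge 8a_{i-1}$ for $2\le i\le m$; $\hat a_m=a_m+x$ for some integer $x\ge 7a_m$; $a_{m+i}=\hat a_m+a_m-a_{m-i}$ for $1\le i\le m-1$; and $a_{2m}=\hat a_m+a_m$. Then $A_k$ is not compact.
   Context: All $a_i$ (and $\hat a_m$) are positive integers. A set $A_k$ of $k$ positive integers with smallest element $1$ and largest element $M$ is called compact if every integer $n$ with $0\le n\le kM$ can be written as a sum of at most $k$ elements of $A_k$, with repetitions allowed (the empty sum being $0$). In both forms considered, the largest element is $M=a_{2m}$; in the second form the set has $2m+1$ elements, and the extra middle element is denoted $\hat a_m$.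
   Formalization: Form (1) is assumed only for m ≥ 2: for m = 1 it gives exactly the set {1,2}, which is compact (0, 1, 2, 1+2, 2+2 cover 0 to 4), so the claim fails there; form (2) is kept for all m ≥ 1. *)

theory Defs
  imports Main "HOL-Library.Multiset"
begin

text \<open>
  Compactness is only meant for finite sets of positive integers with least element 1; here
  k is \<open>card A\<close> and the largest element M is \<open>Max A\<close>. A sum of at most k elements
  with repetitions is the sum of a multiset over A of size at most k.
\<close>

definition compact_set :: "nat set \<Rightarrow> bool" where
  "compact_set A \<longleftrightarrow>
     (\<forall>n \<le> card A * Max A.
        \<exists>S. set_mset S \<subseteq> A \<and> size S \<le> card A \<and> sum_mset S = n)"

text \<open>
  Only the values \<open>a 1, \<dots>, a (2 * m)\<close> of the sequence matter. The subtractions of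
  type \<^typ>\<open>nat\<close> below do not truncate, since \<open>a (m - i) < a m\<close> for \<open>1 \<le> i \<le> m - 1\<close>.
\<close>

definition even_form :: "nat \<Rightarrow> nat set \<Rightarrow> bool" where
  "even_form m A \<longleftrightarrow>
     card A = 2 * m \<and>
     (\<exists>a :: nat \<Rightarrow> nat.
        A = a ` {1..2 * m} \<and>
        strict_mono_on {1..2 * m} a \<and>
        a 1 = 1 \<and>
        (\<forall>i. 2 \<le> i \<and> i \<le> m \<longrightarrow> a i \<ge> 8 * a (i - 1)) \<and>
        (\<forall>i. 1 \<le> i \<and> i \<le> m - 1 \<longrightarrow> a (m + i) = 2 * a m - a (m - i)) \<and>
        a (2 * m) = 2 * a m)"

definition odd_form :: "nat \<Rightarrow> nat set \<Rightarrow> bool" where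
  "odd_form m A \<longleftrightarrow>
     card A = 2 * m + 1 \<and>
     (\<exists>(a :: nat \<Rightarrow> nat) (ahat :: nat).
        A = insert ahat (a ` {1..2 * m}) \<and>
        strict_mono_on {1..2 * m} a \<and>
        a m < ahat \<and> ahat < a (m + 1) \<and>
        a 1 = 1 \<and>
        (\<forall>i. 2 \<le> i \<and> i \<le> m \<longrightarrow> a i \<ge> 8 * a (i - 1)) \<and>
        (\<exists>x. x \<ge> 7 * a m \<and> ahat = a m + x) \<and>
        (\<forall>i. 1 \<le> i \<and> i \<le> m - 1 \<longrightarrow> a (m + i) = ahat + a m - a (m - i)) \<and>
        a (2 * m) = ahat + a m)"

text \<open>
  The even form with \<open>m = 1\<close> admits exactly one set, \<open>{1, 2}\<close>, and that set is
  compact. It therefore has to be excluded from any non-compactness claim.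
\<close>

lemma even_form_1_iff: "even_form 1 A \<longleftrightarrow> A = {1, 2}"
proof
  have I: "{1..2 * (1::nat)} = {1, 2}" by auto
  { assume "even_form 1 A"
    then show "A = {1, 2}" unfolding even_form_def I by auto }
  { assume A: "A = {1, 2}"
    show "even_form 1 A" unfolding even_form_def I A
      by (intro conjI exI[of _ "\<lambda>i. i"]) (auto simp: strict_mono_on_def) }
qed

lemma compact_set_1_2: "compact_set {1, 2}"
  unfolding compact_set_def
proof (intro allI impI)
  fix n :: nat
  assume "n \<le> card {1, 2 :: nat} * Max {1, 2 :: nat}"
  then have "n \<le> 4" by simp
  then consider "n = 0" | "n = 1" | "n = 2" | "n = 3" | "n = 4" by linarith
  then show "\<exists>S. set_mset S \<subseteq> {1, 2} \<and> size S \<le> card {1, 2 :: nat} \<and> sum_mset S = n"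
  proof cases
    case 1 then show ?thesis by (intro exI[of _ "{#}"]) simp
  next
    case 2 then show ?thesis by (intro exI[of _ "{#1#}"]) simp
  next
    case 3 then show ?thesis by (intro exI[of _ "{#2#}"]) simp
  next
    case 4 then show ?thesis by (intro exI[of _ "{#1, 2#}"]) simp
  next
    case 5 then show ?thesis by (intro exI[of _ "{#2, 2#}"]) simp
  qed
qed

end

theory Submission
  imports Defs
begin

text \<open>
  Compactness fails already for small targets, by counting. Suppose that \<open>j\<close> elements of the
  set lie below some \<open>b\<close> and that the set has at most \<open>2 j + 2\<close> elements. A sum
  below \<open>b\<close> can only use those \<open>j\<close> small elements, and there are at most
  \<open>(3 j + 2) choose j\<close> multisets of at most \<open>2 j + 2\<close> of them. This binomial
  coefficient grows like \<open>(27 / 4) ^ j\<close>, hence stays below \<open>8 ^ j\<close>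
  (\<open>choose_less_power_eight\<close>). On the other hand, the factor 8 in the growth condition gives
  \<open>b \<ge> 8 ^ j\<close> for a suitable \<open>b\<close>, so some of the \<open>b\<close> integers below
  \<open>b\<close> are not sums (\<open>not_compact_if_gap\<close>).

  In the even form one takes \<open>b = a m\<close>, with the \<open>j = m - 1\<close> elements
  \<open>a 1, \<dots>, a (m - 1)\<close> below it; then \<open>2 j + 2 = 2 m\<close>. In the odd form one takes
  for \<open>b\<close> the middle element \<open>a m + x \<ge> 8 * a m\<close>, with the \<open>j = m\<close> elements
  \<open>a 1, \<dots>, a m\<close> below it. Some small element is
  needed, since for \<open>j = 0\<close> both counts are 1; this is where the even form with
  \<open>m = 1\<close> drops out, and the set \<open>{1, 2}\<close> is indeed compact.
\<close>

lemma card_bounded_multisets: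
  assumes "finite B" "B \<noteq> {}"
  shows "finite (\<Union>n\<le>s. multisets_of_size B n)"
    and "card (\<Union>n\<le>s. multisets_of_size B n) = (card B + s) choose card B"
proof -
  have B: "0 < card B" using assms by (simp add: card_gt_0_iff)
  have fin: "finite (multisets_of_size B n)" for n
    using assms(1) by (rule finite_multisets_of_size)
  then show "finite (\<Union>n\<le>s. multisets_of_size B n)" by simp
  have "card (\<Union>n\<le>s. multisets_of_size B n) = (\<Sum>n\<le>s. card (multisets_of_size B n))"
    using fin by (intro card_UN_disjoint) (auto simp: multisets_of_size_def)
  also have "\<dots> = (\<Sum>n\<le>s. (card B - 1 + n) choose n)"
    using B by (intro sum.cong) (auto simp: card_multisets_of_size assms)
  also have "\<dots> = (card B + s) choose s"
    using B sum_choose_lower[of "card B - 1" s] by simp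
  also have "\<dots> = (card B + s) choose card B"
    using binomial_symmetric[of s "card B + s"] by simp
  finally show "card (\<Union>n\<le>s. multisets_of_size B n) = (card B + s) choose card B" .
qed

text \<open>
  Consecutive coefficients have the ratio \<open>3 (3 j + 5) (3 j + 4) / ((2 j + 4) (2 j + 3))\<close>,
  which is less than 8. At \<open>j = 0\<close> both sides are 1, so the strict bound starts with
  \<open>5 < 8\<close>.
\<close>

lemma choose_less_power_eight:
  assumes "1 \<le> j"
  shows "(3 * j + 2) choose j < 8 ^ j"
  using assms
proof (induction j rule: dec_induct)
  case base
  show ?case by simp
next
  case (step j)
  define c where "c = (3 * j + 2) choose j"
  define d where "d = (3 * Suc j + 2) choose (Suc j)"
  have idx: "3 * j + 5 = Suc (Suc (Suc (3 * j + 2)))" "2 * j + 4 = Suc (Suc (2 * j + 2))"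
    by simp_all
  have c: "fact j * fact (2 * j + 2) * c = (fact (3 * j + 2) :: nat)"
    using binomial_fact_lemma[of j "3 * j + 2"] unfolding c_def by (simp add: algebra_simps)
  have top: "3 * Suc j + 2 = 3 * j + 5" "3 * j + 5 - Suc j = 2 * j + 4" by simp_all
  have "fact (Suc j) * fact (2 * j + 4) * d = (fact (3 * j + 5) :: nat)"
    using binomial_fact_lemma[of "Suc j" "3 * j + 5"] unfolding d_def top by linarith
  moreover have "fact (3 * j + 5) =
      (3 * j + 5) * ((3 * j + 4) * ((3 * j + 3) * (fact (3 * j + 2) :: nat)))"
    unfolding idx(1) fact_Suc by (simp add: algebra_simps del: fact_Suc)
  moreover have "fact (2 * j + 4) = (2 * j + 4) * ((2 * j + 3) * (fact (2 * j + 2) :: nat))"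
    unfolding idx(2) fact_Suc by (simp add: algebra_simps del: fact_Suc)
  ultimately have eq: "(Suc j * fact j) * ((2 * j + 4) * ((2 * j + 3) * fact (2 * j + 2))) * d =
      (3 * j + 5) * ((3 * j + 4) * ((3 * j + 3) * (fact j * fact (2 * j + 2) * c)))"
    unfolding c by (simp only: fact_Suc of_nat_id)
  \<comment> \<open>The factorials are generalised to \<open>F\<close> and \<open>G\<close> because simplification would
    expand them; what remains is a polynomial identity, using \<open>3 j + 3 = 3 (j + 1)\<close>.\<close>
  have "F * G * (j + 1) * ((2 * j + 4) * (2 * j + 3) * d) =
      F * G * (j + 1) * (3 * (3 * j + 5) * (3 * j + 4) * c)"
    if "(Suc j * F) * ((2 * j + 4) * ((2 * j + 3) * G)) * d =
      (3 * j + 5) * ((3 * j + 4) * ((3 * j + 3) * (F * G * c)))" for F G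
    using that by (simp add: algebra_simps)
  from this[OF eq] have "(2 * j + 4) * (2 * j + 3) * d = 3 * (3 * j + 5) * (3 * j + 4) * c"
    by (simp only: mult_cancel1) simp
  also have "\<dots> \<le> (2 * j + 4) * (2 * j + 3) * (8 * c)"
  proof -
    have "3 * (3 * j + 5) * (3 * j + 4) \<le> (2 * j + 4) * (2 * j + 3) * 8"
      by (simp add: algebra_simps)
    from mult_right_mono[OF this, of c] show ?thesis by (simp only: mult.assoc)
  qed
  finally have "d \<le> 8 * c" by (simp only: mult_le_cancel1) simp
  also have "\<dots> < 8 ^ Suc j" using step.IH unfolding c_def by simp
  finally show ?case unfolding d_def .
qed

text \<open>
  This is the counting argument. The element \<open>y\<close> ensures \<open>b \<le> card A * Max A\<close>,
  so that compactness promises a sum for every target in \<open>{..<b}\<close>; such a sum uses only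
  elements below \<open>b\<close>, and there are fewer such multisets than targets.
\<close>

lemma not_compact_if_gap:
  fixes A :: "nat set"
  assumes fin: "finite A"
    and j: "1 \<le> j" "card {x \<in> A. x < b} = j"
    and cardA: "card A \<le> 2 * j + 2"
    and b: "8 ^ j \<le> b"
    and y: "y \<in> A" "b \<le> y"
  shows "\<not> compact_set A"
proof
  assume compact: "compact_set A"
  let ?B = "{x \<in> A. x < b}"
  let ?V = "\<Union>n\<le>2 * j + 2. multisets_of_size ?B n"
  have B: "finite ?B" "?B \<noteq> {}" using fin j by (auto simp del: Collect_empty_eq)
  have "j + (2 * j + 2) = 3 * j + 2" by simp
  then have V: "finite ?V" "card ?V = (3 * j + 2) choose j"
    using card_bounded_multisets[OF B, of "2 * j + 2"] unfolding j(2) by metis+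
  have "{..<b} \<subseteq> sum_mset ` ?V"
  proof
    fix n assume n: "n \<in> {..<b}"
    have "y \<le> Max A" using fin y by simp
    moreover have "0 < card A" using fin y by (auto simp: card_gt_0_iff)
    ultimately have "b \<le> card A * Max A"
      using y by (cases "card A") auto
    with n have "n \<le> card A * Max A" by simp
    then obtain S where S: "set_mset S \<subseteq> A" "size S \<le> card A" "sum_mset S = n"
      using compact unfolding compact_set_def by blast
    have "x < b" if "x \<in># S" for x
    proof -
      have "x \<le> sum_mset S" using that by (metis sum_mset.remove le_add1)
      with S n show ?thesis by simp
    qed
    with S(1,2) cardA have "S \<in> ?V" by (auto simp: multisets_of_size_def)
    with S(3) show "n \<in> sum_mset ` ?V" by blast
  qed
  then have "card {..<b} \<le> card (sum_mset ` ?V)" using V(1) by (intro card_mono) auto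
  also have "\<dots> \<le> card ?V" using V(1) by (rule card_image_le)
  also have "\<dots> < 8 ^ j" using V(2) choose_less_power_eight[OF j(1)] by linarith
  finally show False using b by simp
qed

lemma power_le_if_ratio:
  fixes a :: "nat \<Rightarrow> nat"
  assumes "a 1 = 1"
    and "\<And>i. 2 \<le> i \<Longrightarrow> i \<le> m \<Longrightarrow> r * a (i - 1) \<le> a i"
    and "1 \<le> i" "i \<le> m"
  shows "r ^ (i - 1) \<le> a i"
  using assms(3,4)
proof (induction i rule: dec_induct)
  case base
  show ?case using assms(1) by simp
next
  case (step i)
  have "r ^ i = r * r ^ (i - 1)" using step.hyps by (cases i) auto
  also have "\<dots> \<le> r * a i" using step by simp
  also have "\<dots> \<le> a (Suc i)" using assms(2)[of "Suc i"] step by simp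
  finally show ?case by simp
qed

lemma even_form_not_compact:
  assumes m: "2 \<le> m" and form: "even_form m A"
  shows "\<not> compact_set A"
proof -
  obtain a where cardA: "card A = 2 * m"
    and A: "A = a ` {1..2 * m}" and mono: "strict_mono_on {1..2 * m} a"
    and a1: "a 1 = 1" and ratio: "\<And>i. 2 \<le> i \<Longrightarrow> i \<le> m \<Longrightarrow> 8 * a (i - 1) \<le> a i"
    using form unfolding even_form_def by blast
  have inj: "inj_on a {1..2 * m}" using mono by (rule strict_mono_on_imp_inj_on)
  have less: "a i < a m \<longleftrightarrow> i < m" if "i \<in> {1..2 * m}" for i
    using strict_mono_on_less[OF mono, of i m] that m by auto
  have "{x \<in> A. x < a m} = a ` {1..<m}"
    unfolding A using less by auto
  moreover have "inj_on a {1..<m}" by (rule inj_on_subset[OF inj]) auto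
  ultimately have small: "card {x \<in> A. x < a m} = m - 1" by (simp add: card_image)
  have "8 ^ (m - 1) \<le> a m" using power_le_if_ratio[of a m 8 m] a1 ratio m by simp
  moreover have "a m \<in> A" using m unfolding A by auto
  ultimately show ?thesis
    using not_compact_if_gap[of A "m - 1" "a m" "a m"] small cardA m A by simp
qed

lemma odd_form_not_compact:
  assumes m: "1 \<le> m" and form: "odd_form m A"
  shows "\<not> compact_set A"
proof -
  obtain a h x where cardA: "card A = 2 * m + 1"
    and A: "A = insert h (a ` {1..2 * m})" and mono: "strict_mono_on {1..2 * m} a"
    and h: "a m < h" "h < a (m + 1)"
    and a1: "a 1 = 1" and ratio: "\<And>i. 2 \<le> i \<Longrightarrow> i \<le> m \<Longrightarrow> 8 * a (i - 1) \<le> a i"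
    and x: "7 * a m \<le> x" "h = a m + x"
    using form unfolding odd_form_def by blast
  have inj: "inj_on a {1..2 * m}" using mono by (rule strict_mono_on_imp_inj_on)
  have less: "a i < h \<longleftrightarrow> i \<le> m" if i: "i \<in> {1..2 * m}" for i
  proof (cases "i \<le> m")
    case True
    then have "a i \<le> a m" using strict_mono_on_leD[OF mono, of i m] i m by simp
    with True h show ?thesis by simp
  next
    case False
    then have "a (m + 1) \<le> a i" using strict_mono_on_leD[OF mono, of "m + 1" i] i m by simp
    with False h show ?thesis by simp
  qed
  have "{x \<in> A. x < h} = a ` {1..m}"
    unfolding A using less by auto
  moreover have "inj_on a {1..m}" by (rule inj_on_subset[OF inj]) auto
  ultimately have small: "card {x \<in> A. x < h} = m" by (simp add: card_image)
  have "8 ^ m = 8 * 8 ^ (m - 1)" using m by (cases m) auto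
  also have "\<dots> \<le> 8 * a m" using power_le_if_ratio[of a m 8 m] a1 ratio m by simp
  also have "\<dots> \<le> h" using x by simp
  finally have "8 ^ m \<le> h" .
  then show ?thesis
    using not_compact_if_gap[of A m h h] small cardA m A by simp
qed

theorem theorem3p1:
  fixes m :: nat and A :: "nat set"
  assumes "m \<ge> 1"
    and "(even_form m A \<and> m \<noteq> 1) \<or> odd_form m A"
  shows "\<not> compact_set A"
  using assms even_form_not_compact[of m A] odd_form_not_compact[of m A] by linarith

end
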